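(* Let $X$ be a compact metric space. Then for every $m\in\mathbb{N}$ with $m\le\#X$ and every $\lambda>0$ there exists an irreducible optimal correspondence $R\in\mathcal{R}^0_{\mathrm{opt}}(\lambda\Delta_m,X)$ such that the family $\{R(i)\}_{i\in\lambda\Delta_m}$ is a partition of $X$ (the sets $R(i)$, for distinct $i$, are pairwise disjoint and nonempty with union $X$). In particular, if $m=\#X$, then one can take a bijection as an optimal correspondence $R$.
   Context: $\mathbb{N}=\{1,2,\ldots\}$, $\#X$ is the cardinality of $X$, and $d_{GH}$ is the Gromov--Hausdorff distance. $\lambda\Delta_m$ denotes the $m$-point metric space (simplex) all of whose nonzero distances equal $\lambda$. A correspondence between sets $Y$ and $X$ is a subset $R\subset Y\times X$ whose projections to $Y$ and to $X$ are both surjective; $R(y)=\{x\in X:(y,x)\in R\}$. Its distortion for metric spaces $Y,X$ is $\operatorname{dis}R=\sup\{\,||yy'|-|xx'||:(y,x),(y',x')\in R\}$, where $|\cdot\,\cdot|$ denotes distance. A correspondence is optimal if $d_{GH}(Y,X)=\frac12\operatorname{dis}R$, and irreducible if it is minimal with respect to inclusion among all correspondences between $Y$ and $X$. $\mathcal{R}^0_{\mathrm{opt}}(Y,X)$ is the set of all correspondences that are both optimal and irreducible. *)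

theory Defs
  imports "HOL-Analysis.Analysis"
begin

text \<open>A metric space is an element of the library type \<open>'a metric\<close>: it has an explicit carrier
  \<open>mspace X\<close>, so spaces of every cardinality can be treated uniformly.  Suprema and infima of
  distances are taken in \<open>ennreal\<close>, so that they have their usual meaning for unbounded spaces
  as well.\<close>

definition isometric_embedding :: "'a metric \<Rightarrow> 'b metric \<Rightarrow> ('a \<Rightarrow> 'b) \<Rightarrow> bool" where
  "isometric_embedding X Z f \<longleftrightarrow> f ` mspace X \<subseteq> mspace Z \<and>
     (\<forall>x\<in>mspace X. \<forall>x'\<in>mspace X. mdist Z (f x) (f x') = mdist X x x')"

definition hausdorff_dist :: "'a metric \<Rightarrow> 'a set \<Rightarrow> 'a set \<Rightarrow> ennreal" where
  "hausdorff_dist Z A B =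
     Inf {ennreal r | r. 0 < r \<and> A \<subseteq> (\<Union>b\<in>B. mball_of Z b r) \<and> B \<subseteq> (\<Union>a\<in>A. mball_of Z a r)}"

text \<open>The Gromov--Hausdorff distance is the infimum of the Hausdorff distances between isometric
  copies of \<open>X\<close> and \<open>Y\<close> in a common metric space \<open>Z\<close>.  It is enough to let \<open>Z\<close> range over the
  metric spaces with points in \<open>'a + 'b\<close>, because only the points of the two copies matter;
  lemma \<open>gh_dist_le_hausdorff_dist\<close> below shows that a \<open>Z\<close> over any other type
  cannot make the infimum smaller.\<close>

definition gh_dist :: "'a metric \<Rightarrow> 'b metric \<Rightarrow> ennreal" where
  "gh_dist X Y = Inf {hausdorff_dist Z (f ` mspace X) (g ` mspace Y) | (Z :: ('a + 'b) metric) f g.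
     isometric_embedding X Z f \<and> isometric_embedding Y Z g}"

text \<open>The simplex \<open>\<lambda>\<Delta>\<^sub>m\<close>; meaningful for \<open>l > 0\<close> only, since otherwise the argument of
  \<open>metric\<close> is not a metric space.\<close>

definition simplex_metric :: "real \<Rightarrow> nat \<Rightarrow> nat metric" where
  "simplex_metric l m = metric ({1..m}, \<lambda>i j. if i = j then 0 else l)"

definition correspondence :: "'a metric \<Rightarrow> 'b metric \<Rightarrow> ('a \<times> 'b) set \<Rightarrow> bool" where
  "correspondence Y X R \<longleftrightarrow>
     R \<subseteq> mspace Y \<times> mspace X \<and> fst ` R = mspace Y \<and> snd ` R = mspace X"

definition distortion :: "'a metric \<Rightarrow> 'b metric \<Rightarrow> ('a \<times> 'b) set \<Rightarrow> ennreal" where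
  "distortion Y X R =
     Sup {ennreal \<bar>mdist Y y y' - mdist X x x'\<bar> | y x y' x'. (y, x) \<in> R \<and> (y', x') \<in> R}"

definition optimal_correspondence :: "'a metric \<Rightarrow> 'b metric \<Rightarrow> ('a \<times> 'b) set \<Rightarrow> bool" where
  "optimal_correspondence Y X R \<longleftrightarrow> correspondence Y X R \<and> gh_dist Y X = distortion Y X R / 2"

definition irreducible_correspondence :: "'a metric \<Rightarrow> 'b metric \<Rightarrow> ('a \<times> 'b) set \<Rightarrow> bool" where
  "irreducible_correspondence Y X R \<longleftrightarrow>
     correspondence Y X R \<and> (\<forall>S. correspondence Y X S \<and> S \<subseteq> R \<longrightarrow> S = R)"

definition R0_opt :: "'a metric \<Rightarrow> 'b metric \<Rightarrow> ('a \<times> 'b) set set" where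
  "R0_opt Y X = {R. optimal_correspondence Y X R \<and> irreducible_correspondence Y X R}"

lemma Metric_space_simplex:
  assumes "0 < l"
  shows "Metric_space {1..m} (\<lambda>i j. if i = j then 0 else l)"
  using assms by unfold_locales auto

lemma mspace_simplex_metric: "0 < l \<Longrightarrow> mspace (simplex_metric l m) = {1..m}"
  unfolding simplex_metric_def
  by (rule Metric_space.mspace_metric[OF Metric_space_simplex])

lemma mdist_simplex_metric: "0 < l \<Longrightarrow> mdist (simplex_metric l m) i j = (if i = j then 0 else l)"
  unfolding simplex_metric_def
  by (subst Metric_space.mdist_metric[OF Metric_space_simplex]) auto

lemma gh_dist_le_hausdorff_dist:
  fixes X :: "'a metric" and Y :: "'b metric" and Z :: "'c metric"
  assumes f: "isometric_embedding X Z f" and g: "isometric_embedding Y Z g"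
  shows "gh_dist X Y \<le> hausdorff_dist Z (f ` mspace X) (g ` mspace Y)"
proof -
  define P where "P = f ` mspace X \<union> g ` mspace Y"
  define s :: "'a + 'b \<Rightarrow> 'c" where "s = case_sum f g"
  define t where "t = inv_into (Inl ` mspace X \<union> Inr ` mspace Y) s"
  have P: "P = s ` (Inl ` mspace X \<union> Inr ` mspace Y)"
    unfolding P_def s_def by (auto simp: image_Un image_image)
  have st: "s (t p) = p" if "p \<in> P" for p
    using that unfolding P t_def by (rule f_inv_into_f)
  have PZ: "P \<subseteq> mspace Z"
    using f g by (auto simp: P_def isometric_embedding_def)
  have ms: "Metric_space (t ` P) (\<lambda>u v. mdist Z (s u) (s v))"
  proof
    show "mdist Z (s u) (s v) = 0 \<longleftrightarrow> u = v" if uv: "u \<in> t ` P" "v \<in> t ` P" for u v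
    proof -
      obtain p q where pq: "p \<in> P" "u = t p" "q \<in> P" "v = t q"
        using uv by blast
      have "mdist Z p q = 0 \<longleftrightarrow> p = q" using pq PZ by (meson mdist_zero subsetD)
      then show ?thesis using pq st by metis
    qed
    show "mdist Z (s u) (s w) \<le> mdist Z (s u) (s v) + mdist Z (s v) (s w)"
      if "u \<in> t ` P" "v \<in> t ` P" "w \<in> t ` P" for u v w
    proof -
      have "s u \<in> mspace Z" "s v \<in> mspace Z" "s w \<in> mspace Z"
        using that st PZ by auto
      then show ?thesis by (rule mdist_triangle)
    qed
  qed (auto simp: mdist_commute)
  define W where "W = metric (t ` P, \<lambda>u v. mdist Z (s u) (s v))"
  have sW: "mspace W = t ` P" and dW: "mdist W = (\<lambda>u v. mdist Z (s u) (s v))"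
    unfolding W_def
    by (rule Metric_space.mspace_metric[OF ms], rule Metric_space.mdist_metric[OF ms])
  have d: "mdist W (t p) (t q) = mdist Z p q" if "p \<in> P" "q \<in> P" for p q
    using that by (simp add: dW st)
  have fW: "isometric_embedding X W (t \<circ> f)" and gW: "isometric_embedding Y W (t \<circ> g)"
    using f g by (auto simp: isometric_embedding_def sW d P_def)
  have cover: "(t \<circ> h) ` A \<subseteq> (\<Union>b\<in>(t \<circ> k) ` B. mball_of W b r)"
    if hk: "h ` A \<subseteq> (\<Union>b\<in>k ` B. mball_of Z b r)" "h ` A \<subseteq> P" "k ` B \<subseteq> P"
    for h k r and A :: "'e set" and B :: "'f set"
  proof
    fix u assume "u \<in> (t \<circ> h) ` A"
    then obtain a where a: "a \<in> A" "u = t (h a)" by auto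
    then obtain b where b: "b \<in> B" "h a \<in> mball_of Z (k b) r"
      using hk(1) by blast
    have "h a \<in> P" "k b \<in> P" using a b hk by auto
    then have "t (h a) \<in> mball_of W (t (k b)) r"
      using b(2) by (auto simp: in_mball_of sW d)
    then show "u \<in> (\<Union>b\<in>(t \<circ> k) ` B. mball_of W b r)"
      using a b by auto
  qed
  have "hausdorff_dist W ((t \<circ> f) ` mspace X) ((t \<circ> g) ` mspace Y)
      \<le> hausdorff_dist Z (f ` mspace X) (g ` mspace Y)"
    unfolding hausdorff_dist_def
  proof (rule Inf_superset_mono, clarify)
    fix r :: real
    assume r: "0 < r" "f ` mspace X \<subseteq> (\<Union>b\<in>g ` mspace Y. mball_of Z b r)"
      "g ` mspace Y \<subseteq> (\<Union>a\<in>f ` mspace X. mball_of Z a r)"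
    show "\<exists>r'. ennreal r = ennreal r' \<and> 0 < r' \<and>
        (t \<circ> f) ` mspace X \<subseteq> (\<Union>b\<in>(t \<circ> g) ` mspace Y. mball_of W b r') \<and>
        (t \<circ> g) ` mspace Y \<subseteq> (\<Union>a\<in>(t \<circ> f) ` mspace X. mball_of W a r')"
      using r(1) cover[OF r(2)] cover[OF r(3)] unfolding P_def by blast
  qed
  moreover have "gh_dist X Y \<le> hausdorff_dist W ((t \<circ> f) ` mspace X) ((t \<circ> g) ` mspace Y)"
    unfolding gh_dist_def using fW gW by (intro Inf_lower) blast
  ultimately show ?thesis by (rule order_trans[rotated])
qed

end

theory Submission
  imports Defs
begin

text \<open>The argument combines the existence of an optimal correspondence between compact spaces with
  a repair of that correspondence that is special to simplices.

  First, \<open>gh_dist Y X\<close> is half the infimum of the distortions of correspondences.  If two isometric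
  copies are at Hausdorff distance less than \<open>s\<close>, the pairs of points at distance less than \<open>s\<close> form
  a correspondence of distortion at most \<open>2 * s\<close>; conversely, a correspondence of distortion at most
  \<open>2 * s\<close> allows gluing the two spaces so that related points are at distance \<open>s\<close>
  (\<open>correspondence_of_gh_dist_less\<close>, \<open>gh_dist_le_half_distortion\<close>).

  Secondly, for compact spaces the infimum is attained (\<open>exists_optimal_correspondence\<close>).  Only
  correspondences made of a map \<open>Y \<rightarrow> X\<close> and a map \<open>X \<rightarrow> Y\<close> matter, since every correspondence
  contains one of these.  The pairs of maps form a product of compact spaces, hence a compact space
  by Tychonoff, and there a bound on the distortion is a closed condition; the nested
  conditions with bounds decreasing to the infimum have a common solution.

  Finally, let \<open>R\<close> be a correspondence between the simplex and \<open>X\<close>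
  (\<open>exists_partition_distortion_le\<close>).  If the sets \<open>R `` {i}\<close> are disjoint, they already form a
  partition.  Otherwise one point is related to two vertices, so the distortion is at least \<open>l\<close>.
  Then choose for every point one vertex related to it and refine the resulting colouring until all
  \<open>m\<close> colours occur.  Under refinement the classes only shrink, and for points of different classes
  the defect \<open>\<bar>l - mdist X x x'\<bar>\<close> is at most \<open>l\<close> unless \<open>mdist X x x' > l\<close>, in which
  case it is bounded by the defect of the original pairs.  So the distortion does not grow.  A
  colouring, seen as a correspondence, is irreducible because each point of \<open>X\<close> occurs in it
  only once.\<close>

section \<open>Gromov--Hausdorff distance and distortion\<close>

lemma distortion_le_iff:
  "distortion Y X R \<le> B \<longleftrightarrow>
     (\<forall>(y, x)\<in>R. \<forall>(y', x')\<in>R. ennreal \<bar>mdist Y y y' - mdist X x x'\<bar> \<le> B)"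
  unfolding distortion_def Sup_le_iff by blast

text \<open>Besides positivity, the hypotheses on the cross distances \<open>c\<close> are exactly the triangle
  inequalities that involve both spaces.  The absolute values make the distance nonnegative also outside the carrier,
  as \<open>Metric_space\<close> demands.\<close>

lemma Metric_space_disjoint_union:
  fixes Y :: "'a metric" and X :: "'b metric" and c :: "'a \<Rightarrow> 'b \<Rightarrow> real"
  defines "d \<equiv> \<lambda>u v. case u of
      Inl y \<Rightarrow> (case v of Inl y' \<Rightarrow> mdist Y y y' | Inr x \<Rightarrow> \<bar>c y x\<bar>)
    | Inr x \<Rightarrow> (case v of Inl y \<Rightarrow> \<bar>c y x\<bar> | Inr x' \<Rightarrow> mdist X x x')"
  assumes pos: "\<And>y x. \<lbrakk>y \<in> mspace Y; x \<in> mspace X\<rbrakk> \<Longrightarrow> 0 < c y x"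
    and left: "\<And>y y' x. \<lbrakk>y \<in> mspace Y; y' \<in> mspace Y; x \<in> mspace X\<rbrakk>
      \<Longrightarrow> c y x \<le> mdist Y y y' + c y' x"
    and right: "\<And>y x x'. \<lbrakk>y \<in> mspace Y; x \<in> mspace X; x' \<in> mspace X\<rbrakk>
      \<Longrightarrow> c y x \<le> c y x' + mdist X x' x"
    and left2: "\<And>y y' x. \<lbrakk>y \<in> mspace Y; y' \<in> mspace Y; x \<in> mspace X\<rbrakk>
      \<Longrightarrow> mdist Y y y' \<le> c y x + c y' x"
    and right2: "\<And>y x x'. \<lbrakk>y \<in> mspace Y; x \<in> mspace X; x' \<in> mspace X\<rbrakk>
      \<Longrightarrow> mdist X x x' \<le> c y x + c y x'"
  shows "Metric_space (mspace Y <+> mspace X) d"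
proof
  show "d u v = 0 \<longleftrightarrow> u = v" if "u \<in> mspace Y <+> mspace X" "v \<in> mspace Y <+> mspace X" for u v
    using that by (auto simp: d_def dest: pos)
  show "d u w \<le> d u v + d v w" if "u \<in> mspace Y <+> mspace X" "v \<in> mspace Y <+> mspace X"
    "w \<in> mspace Y <+> mspace X" for u v w
  proof -
    have p: "\<bar>c y x\<bar> = c y x" if "y \<in> mspace Y" "x \<in> mspace X" for y x
      using pos[OF that] by simp
    note tri = mdist_triangle left right left2 right2
    show ?thesis
      using that
      by (elim PlusE)
        (simp_all add: d_def p tri mdist_commute add.commute,
          (metis left right mdist_commute add.commute)+)
  qed
qed (auto simp: d_def mdist_commute split: sum.split)

text \<open>The two spaces are glued along bridges of length \<open>s\<close> between related points: the distance from
  \<open>y\<close> to \<open>x\<close> is the infimum of the lengths of paths that use one bridge.  A detour through the other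
  space pays \<open>2 * s\<close> for its two bridges and saves at most the distortion, hence it is never a
  shortcut, and the original distances survive.\<close>

lemma gh_dist_le_of_distortion:
  fixes Y :: "'a metric" and X :: "'b metric"
  assumes R: "correspondence Y X R"
    and s: "0 < s"
    and dis: "distortion Y X R \<le> ennreal (2 * s)"
  shows "gh_dist Y X \<le> ennreal s"
proof -
  define c where "c y x = (INF p\<in>R. mdist Y y (fst p) + s + mdist X (snd p) x)" for y x
  have RY: "y \<in> mspace Y" and RX: "x \<in> mspace X" if "(y, x) \<in> R" for y x
    using R that by (auto simp: correspondence_def)
  have ne: "R \<noteq> {}" if "y \<in> mspace Y" for y
    using R that by (auto simp: correspondence_def)
  have bound: "\<bar>mdist Y y y' - mdist X x x'\<bar> \<le> 2 * s"
    if "(y, x) \<in> R" "(y', x') \<in> R" for y x y' x'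
    using dis that s unfolding distortion_le_iff by (fastforce simp: ennreal_le_iff)
  have c_le: "c y x \<le> mdist Y y b + s + mdist X a x" if "(b, a) \<in> R" for y x b a
    unfolding c_def
    using cINF_lower[OF bdd_belowI2[of _ 0] that, of "\<lambda>p. mdist Y y (fst p) + s + mdist X (snd p) x"] s
    by simp
  have le_c: "t \<le> c y x"
    if "y \<in> mspace Y" "\<And>b a. (b, a) \<in> R \<Longrightarrow> t \<le> mdist Y y b + s + mdist X a x" for t y x
    unfolding c_def using ne that by (intro cINF_greatest) auto
  \<comment> \<open>To bound a sum of two infima from below, bound all sums of their members.\<close>
  have le_cc: "t \<le> c y x + c y' x'"
    if y: "y \<in> mspace Y" and y': "y' \<in> mspace Y"
      and t: "\<And>b a b' a'. \<lbrakk>(b, a) \<in> R; (b', a') \<in> R\<rbrakk> \<Longrightarrow>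
        t \<le> (mdist Y y b + s + mdist X a x) + (mdist Y y' b' + s + mdist X a' x')"
    for t y x y' x'
  proof -
    have *: "t - (mdist Y y b + s + mdist X a x) \<le> c y' x'" if ba: "(b, a) \<in> R" for b a
    proof (rule le_c[OF y'])
      fix b' a' assume "(b', a') \<in> R"
      from t[OF ba this]
      show "t - (mdist Y y b + s + mdist X a x) \<le> mdist Y y' b' + s + mdist X a' x'"
        by simp
    qed
    have "t - c y' x' \<le> c y x"
    proof (rule le_c[OF y])
      fix b a assume "(b, a) \<in> R"
      from *[OF this] show "t - c y' x' \<le> mdist Y y b + s + mdist X a x" by simp
    qed
    then show ?thesis by simp
  qed
  define d where "d = (\<lambda>u v. case u of
      Inl y \<Rightarrow> (case v of Inl y' \<Rightarrow> mdist Y y y' | Inr x \<Rightarrow> \<bar>c y x\<bar>)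
    | Inr x \<Rightarrow> (case v of Inl y \<Rightarrow> \<bar>c y x\<bar> | Inr x' \<Rightarrow> mdist X x x'))"
  have s_le: "s \<le> c y x" if "y \<in> mspace Y" for y x
    using that by (intro le_c) auto
  have ms: "Metric_space (mspace Y <+> mspace X) d"
    unfolding d_def
  proof (rule Metric_space_disjoint_union)
    show "0 < c y x" if "y \<in> mspace Y" for y x
      using s_le[OF that, of x] s by simp
    show "c y x \<le> mdist Y y y' + c y' x"
      if "y \<in> mspace Y" "y' \<in> mspace Y" for y y' x
    proof -
      have "c y x - mdist Y y y' \<le> c y' x"
      proof (rule le_c[OF that(2)])
        fix b a assume ba: "(b, a) \<in> R"
        show "c y x - mdist Y y y' \<le> mdist Y y' b + s + mdist X a x"
          using c_le[OF ba, of y x] mdist_triangle[OF that RY[OF ba]] by simp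
      qed
      then show ?thesis by simp
    qed
    show "c y x \<le> c y x' + mdist X x' x"
      if "y \<in> mspace Y" "x \<in> mspace X" "x' \<in> mspace X" for y x x'
    proof -
      have "c y x - mdist X x' x \<le> c y x'"
      proof (rule le_c[OF that(1)])
        fix b a assume ba: "(b, a) \<in> R"
        show "c y x - mdist X x' x \<le> mdist Y y b + s + mdist X a x'"
          using c_le[OF ba, of y x] mdist_triangle[OF RX[OF ba] that(3,2)] by simp
      qed
      then show ?thesis by simp
    qed
    show "mdist Y y y' \<le> c y x + c y' x"
      if y: "y \<in> mspace Y" "y' \<in> mspace Y" and x: "x \<in> mspace X" for y y' x
    proof (rule le_cc[OF y])
      fix b a b' a' assume ba: "(b, a) \<in> R" "(b', a') \<in> R"
      show "mdist Y y y' \<le> (mdist Y y b + s + mdist X a x) + (mdist Y y' b' + s + mdist X a' x)"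
        using bound[OF ba] mdist_triangle[OF RX[OF ba(1)] x RX[OF ba(2)]]
          mdist_triangle[OF y(1) RY[OF ba(1)] y(2)]
          mdist_triangle[OF RY[OF ba(1)] RY[OF ba(2)] y(2)]
        by (simp add: mdist_commute)
    qed
    show "mdist X x x' \<le> c y x + c y x'"
      if y: "y \<in> mspace Y" and x: "x \<in> mspace X" "x' \<in> mspace X" for y x x'
    proof (rule le_cc[OF y y])
      fix b a b' a' assume ba: "(b, a) \<in> R" "(b', a') \<in> R"
      show "mdist X x x' \<le> (mdist Y y b + s + mdist X a x) + (mdist Y y b' + s + mdist X a' x')"
        using bound[OF ba] mdist_triangle[OF RY[OF ba(1)] y RY[OF ba(2)]]
          mdist_triangle[OF x(1) RX[OF ba(1)] x(2)]
          mdist_triangle[OF RX[OF ba(1)] RX[OF ba(2)] x(2)]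
        by (simp add: mdist_commute)
    qed
  qed
  define Z where "Z = metric (mspace Y <+> mspace X, d)"
  have sZ: "mspace Z = mspace Y <+> mspace X" and dZ: "mdist Z = d"
    unfolding Z_def by (simp_all add: Metric_space.mspace_metric[OF ms] Metric_space.mdist_metric[OF ms])
  have emb: "isometric_embedding Y Z Inl" "isometric_embedding X Z Inr"
    by (auto simp: isometric_embedding_def sZ dZ d_def)
  have close: "mdist Z (Inl y) (Inr x) \<le> s" if "(y, x) \<in> R" for y x
  proof -
    have "mdist Y y y = 0" "mdist X x x = 0" using RY[OF that] RX[OF that] by simp_all
    then show ?thesis
      using c_le[OF that, of y x] s_le[OF RY[OF that], of x] s by (simp add: dZ d_def)
  qed
  show ?thesis
  \<comment> \<open>Related points are at distance at most \<open>s\<close>, but the balls are open, so the radius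
    must exceed \<open>s\<close>.\<close>
  proof (rule ennreal_le_epsilon)
    fix e :: real assume e: "0 < e"
    have "Inl ` mspace Y \<subseteq> (\<Union>b\<in>Inr ` mspace X. mball_of Z b (s + e))"
    proof clarify
      fix y assume "y \<in> mspace Y"
      then obtain x where "(y, x) \<in> R" using R by (force simp: correspondence_def)
      then show "Inl y \<in> (\<Union>b\<in>Inr ` mspace X. mball_of Z b (s + e))"
        using close e RY RX by (fastforce simp: sZ mdist_commute)
    qed
    moreover have "Inr ` mspace X \<subseteq> (\<Union>a\<in>Inl ` mspace Y. mball_of Z a (s + e))"
    proof clarify
      fix x assume "x \<in> mspace X"
      then obtain y where "(y, x) \<in> R" using R by (force simp: correspondence_def)
      then show "Inr x \<in> (\<Union>a\<in>Inl ` mspace Y. mball_of Z a (s + e))"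
        using close e RY RX by (fastforce simp: sZ)
    qed
    ultimately have "hausdorff_dist Z (Inl ` mspace Y) (Inr ` mspace X) \<le> ennreal (s + e)"
      unfolding hausdorff_dist_def using s e
      by (intro Inf_lower CollectI exI[of _ "s + e"] conjI refl) simp_all
    then show "gh_dist Y X \<le> ennreal s + ennreal e"
      using gh_dist_le_hausdorff_dist[OF emb] s e by (auto simp: ennreal_plus)
  qed
qed

text \<open>Gluing needs bridges of positive length.  Approaching half the distortion from above covers
  correspondences of distortion 0 too.\<close>

lemma gh_dist_le_half_distortion:
  assumes "correspondence Y X R"
  shows "gh_dist Y X \<le> distortion Y X R / 2"
proof (cases "distortion Y X R" rule: ennreal_cases)
  case (real D)
  show ?thesis
  proof (rule ennreal_le_epsilon)
    fix e :: real assume e: "0 < e"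
    have "gh_dist Y X \<le> ennreal (D / 2 + e)"
      using real e by (intro gh_dist_le_of_distortion[OF assms]) (auto intro!: ennreal_leI)
    then show "gh_dist Y X \<le> distortion Y X R / 2 + ennreal e"
      using real e by (simp add: ennreal_plus divide_ennreal[symmetric])
  qed
qed (simp add: ennreal_top_divide)

text \<open>Relate points whose images are close to each other in a common space; replacing both ends of a
  segment by related points changes its length by at most two small distances.\<close>

lemma correspondence_of_gh_dist_less:
  fixes Y :: "'a metric" and X :: "'b metric"
  assumes "gh_dist Y X < ennreal s"
  obtains R where "correspondence Y X R" "distortion Y X R \<le> ennreal (2 * s)"
proof -
  obtain Z :: "('a + 'b) metric" and f g where
    fg: "isometric_embedding Y Z f" "isometric_embedding X Z g"
    and less: "hausdorff_dist Z (f ` mspace Y) (g ` mspace X) < ennreal s"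
    using assms unfolding gh_dist_def Inf_less_iff by blast
  obtain r where r: "0 < r" "r < s"
    and cover: "f ` mspace Y \<subseteq> (\<Union>b\<in>g ` mspace X. mball_of Z b r)"
      "g ` mspace X \<subseteq> (\<Union>a\<in>f ` mspace Y. mball_of Z a r)"
    using less unfolding hausdorff_dist_def Inf_less_iff by (auto simp: ennreal_less_iff)
  have fZ: "f y \<in> mspace Z" if "y \<in> mspace Y" for y
    using fg that by (auto simp: isometric_embedding_def)
  have gZ: "g x \<in> mspace Z" if "x \<in> mspace X" for x
    using fg that by (auto simp: isometric_embedding_def)
  define R where "R = {(y, x) \<in> mspace Y \<times> mspace X. mdist Z (f y) (g x) < r}"
  have "\<exists>x\<in>mspace X. mdist Z (f y) (g x) < r" if "y \<in> mspace Y" for y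
    using cover(1) that by (fastforce simp: mdist_commute)
  moreover have "\<exists>y\<in>mspace Y. mdist Z (f y) (g x) < r" if "x \<in> mspace X" for x
    using cover(2) that by fastforce
  ultimately have "correspondence Y X R"
    unfolding correspondence_def R_def by force
  moreover have "distortion Y X R \<le> ennreal (2 * s)"
    unfolding distortion_le_iff
  proof clarify
    fix y x y' x' assume "(y, x) \<in> R" "(y', x') \<in> R"
    then have m: "y \<in> mspace Y" "x \<in> mspace X" "y' \<in> mspace Y" "x' \<in> mspace X"
      and near: "mdist Z (f y) (g x) < r" "mdist Z (f y') (g x') < r"
      by (auto simp: R_def)
    have "mdist Y y y' = mdist Z (f y) (f y')" "mdist X x x' = mdist Z (g x) (g x')"
      using fg m by (auto simp: isometric_embedding_def)
    moreover have "mdist Z (f y) (f y') \<le> mdist Z (f y) (g x) + (mdist Z (g x) (g x') + mdist Z (f y') (g x'))"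
      using mdist_triangle[OF fZ gZ fZ, of y x y'] mdist_triangle[OF gZ gZ fZ, of x x' y'] m
      by (simp add: mdist_commute)
    moreover have "mdist Z (g x) (g x') \<le> mdist Z (f y) (g x) + (mdist Z (f y) (f y') + mdist Z (f y') (g x'))"
      using mdist_triangle[OF gZ fZ gZ, of x y x'] mdist_triangle[OF fZ fZ gZ, of y y' x'] m
      by (simp add: mdist_commute)
    ultimately show "ennreal \<bar>mdist Y y y' - mdist X x x'\<bar> \<le> ennreal (2 * s)"
      using near r by (intro ennreal_leI) linarith
  qed
  ultimately show thesis by (rule that)
qed

section \<open>Optimal correspondences between compact spaces\<close>

text \<open>The correspondence given by two maps \<open>Y \<rightarrow> X\<close> and \<open>X \<rightarrow> Y\<close>.  In contrast to
  arbitrary relations, pairs of maps are the points of a product of the two spaces, on which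
  Tychonoff's theorem can act.\<close>

definition selection_graph :: "'a metric \<Rightarrow> 'b metric \<Rightarrow> ('a \<Rightarrow> 'b) \<times> ('b \<Rightarrow> 'a) \<Rightarrow> ('a \<times> 'b) set" where
  "selection_graph Y X p = (\<lambda>y. (y, fst p y)) ` mspace Y \<union> (\<lambda>x. (snd p x, x)) ` mspace X"

lemma correspondence_selection_graph:
  assumes "fst p \<in> mspace Y \<rightarrow> mspace X" "snd p \<in> mspace X \<rightarrow> mspace Y"
  shows "correspondence Y X (selection_graph Y X p)"
  using assms by (force simp: correspondence_def selection_graph_def)

lemma exists_selection_graph_subset:
  assumes "correspondence Y X R"
  obtains p where "p \<in> (mspace Y \<rightarrow>\<^sub>E mspace X) \<times> (mspace X \<rightarrow>\<^sub>E mspace Y)"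
    "selection_graph Y X p \<subseteq> R"
proof -
  have "\<forall>y\<in>mspace Y. \<exists>x. (y, x) \<in> R" "\<forall>x\<in>mspace X. \<exists>y. (y, x) \<in> R"
    using assms by (force simp: correspondence_def)+
  then obtain f g where "\<And>y. y \<in> mspace Y \<Longrightarrow> (y, f y) \<in> R" "\<And>x. x \<in> mspace X \<Longrightarrow> (g x, x) \<in> R"
    by metis
  then show thesis
    using assms
    by (intro that[of "(restrict f (mspace Y), restrict g (mspace X))"])
      (fastforce simp: correspondence_def selection_graph_def)+
qed

text \<open>Each pair in the graph depends continuously on the two maps, because the product topology makes
  evaluation at a point continuous; the bound is a conjunction of closed conditions, one for
  each two pairs.\<close>

lemma closedin_distortion_selection_graph_le:
  fixes Y :: "'a metric" and X :: "'b metric"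
  assumes "0 \<le> D"
  defines "T \<equiv> prod_topology (product_topology (\<lambda>_. mtopology_of X) (mspace Y))
    (product_topology (\<lambda>_. mtopology_of Y) (mspace X))"
  shows "closedin T {p \<in> topspace T. distortion Y X (selection_graph Y X p) \<le> ennreal D}"
proof -
  \<comment> \<open>The disjoint union of the carriers indexes both halves of the graph at once.\<close>
  define I where "I = mspace Y <+> mspace X"
  define u where "u p i = (case i of Inl y \<Rightarrow> y | Inr x \<Rightarrow> snd p x)" for p :: "('a \<Rightarrow> 'b) \<times> ('b \<Rightarrow> 'a)" and i
  define v where "v p i = (case i of Inl y \<Rightarrow> fst p y | Inr x \<Rightarrow> x)" for p :: "('a \<Rightarrow> 'b) \<times> ('b \<Rightarrow> 'a)" and i
  have graph: "selection_graph Y X p = (\<lambda>i. (u p i, v p i)) ` I" for p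
    by (auto simp: selection_graph_def I_def u_def v_def Plus_def image_Un image_image)
  have f: "continuous_map T (mtopology_of X) (\<lambda>p. fst p y)" if "y \<in> mspace Y" for y
    using continuous_map_compose[OF continuous_map_fst continuous_map_product_projection[OF that]]
    unfolding T_def comp_def .
  have g: "continuous_map T (mtopology_of Y) (\<lambda>p. snd p x)" if "x \<in> mspace X" for x
    using continuous_map_compose[OF continuous_map_snd continuous_map_product_projection[OF that]]
    unfolding T_def comp_def .
  have cu: "continuous_map T (mtopology_of Y) (\<lambda>p. u p i)"
    and cv: "continuous_map T (mtopology_of X) (\<lambda>p. v p i)" if "i \<in> I" for i
    using that f g by (auto simp: I_def u_def v_def)
  have "closedin T {p \<in> topspace T. \<bar>mdist Y (u p i) (u p j) - mdist X (v p i) (v p j)\<bar> \<in> {..D}}"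
    if "i \<in> I" "j \<in> I" for i j
    by (intro closedin_continuous_map_preimage[where Y = euclidean] continuous_intros cu cv that) simp
  then have "closedin T (topspace T \<inter> (\<Inter>i\<in>I. \<Inter>j\<in>I.
      {p \<in> topspace T. \<bar>mdist Y (u p i) (u p j) - mdist X (v p i) (v p j)\<bar> \<in> {..D}}))"
    by (cases "I = {}") (auto intro!: closedin_Int closedin_INT)
  also have "topspace T \<inter> (\<Inter>i\<in>I. \<Inter>j\<in>I.
      {p \<in> topspace T. \<bar>mdist Y (u p i) (u p j) - mdist X (v p i) (v p j)\<bar> \<in> {..D}})
    = {p \<in> topspace T. distortion Y X (selection_graph Y X p) \<le> ennreal D}"
    using assms(1) by (auto simp: distortion_le_iff graph ennreal_le_iff)
  finally show ?thesis .
qed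

lemma optimal_correspondence_iff:
  "optimal_correspondence Y X R \<longleftrightarrow> correspondence Y X R \<and> distortion Y X R / 2 \<le> gh_dist Y X"
  unfolding optimal_correspondence_def using gh_dist_le_half_distortion by (metis order_antisym order_refl)

text \<open>The sets \<open>C n\<close> of pairs of maps with nearly optimal distortion are closed, decreasing and
  nonempty in a compact space; a point of their intersection is optimal.\<close>

theorem exists_optimal_correspondence:
  fixes Y :: "'a metric" and X :: "'b metric"
  assumes cY: "compact_space (mtopology_of Y)" and cX: "compact_space (mtopology_of X)"
    and ne: "mspace Y \<noteq> {}" "mspace X \<noteq> {}"
  shows "\<exists>R. optimal_correspondence Y X R"
proof (cases "gh_dist Y X" rule: ennreal_cases)
  case top
  have "correspondence Y X (mspace Y \<times> mspace X)"
    using ne by (auto simp: correspondence_def)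
  then show ?thesis
    unfolding optimal_correspondence_iff using top by auto
next
  case (real g)
  define T where "T = prod_topology (product_topology (\<lambda>_. mtopology_of X) (mspace Y))
    (product_topology (\<lambda>_. mtopology_of Y) (mspace X))"
  have topT: "topspace T = (mspace Y \<rightarrow>\<^sub>E mspace X) \<times> (mspace X \<rightarrow>\<^sub>E mspace Y)"
    by (simp add: T_def)
  define C where "C n = {p \<in> topspace T. distortion Y X (selection_graph Y X p)
      \<le> ennreal (2 * (g + inverse (real (Suc n))))}" for n
  have "(\<Inter>n. C n) \<noteq> {}"
  proof (rule compact_space_imp_nest)
    show "compact_space T"
      unfolding T_def using cX cY
      by (simp add: compact_space_prod_topology compact_space_product_topology)
    show "closedin T (C n)" for n
      unfolding C_def T_def using real by (intro closedin_distortion_selection_graph_le) auto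
    show "C n \<noteq> {}" for n
    proof -
      have "gh_dist Y X < ennreal (g + inverse (real (Suc n)))"
        using real by (auto simp: ennreal_less_iff)
      then obtain R where R: "correspondence Y X R"
        "distortion Y X R \<le> ennreal (2 * (g + inverse (real (Suc n))))"
        by (rule correspondence_of_gh_dist_less)
      obtain p where p: "p \<in> topspace T" "selection_graph Y X p \<subseteq> R"
        using exists_selection_graph_subset[OF R(1)] topT by metis
      have "distortion Y X (selection_graph Y X p) \<le> distortion Y X R"
        unfolding distortion_def using p(2) by (intro Sup_subset_mono) blast
      then have "p \<in> C n" using p(1) order_trans[OF _ R(2)] by (simp add: C_def)
      then show ?thesis by blast
    qed
    show "decseq C"
    proof (rule decseq_SucI)
      fix n
      have "ennreal (2 * (g + inverse (real (Suc (Suc n))))) \<le> ennreal (2 * (g + inverse (real (Suc n))))"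
        by (intro ennreal_leI mult_left_mono add_left_mono le_imp_inverse_le) auto
      then show "C (Suc n) \<subseteq> C n"
        unfolding C_def by (auto intro: order_trans simp del: of_nat_Suc)
    qed
  qed
  then obtain p where p: "p \<in> topspace T"
    "\<And>n. distortion Y X (selection_graph Y X p) \<le> ennreal (2 * (g + inverse (real (Suc n))))"
    by (auto simp: C_def)
  have "(\<lambda>n. 2 * (g + inverse (real (Suc n)))) \<longlonglongrightarrow> 2 * (g + 0)"
    by (intro tendsto_mult tendsto_add tendsto_const LIMSEQ_inverse_real_of_nat)
  then have "(\<lambda>n. ennreal (2 * (g + inverse (real (Suc n))))) \<longlonglongrightarrow> ennreal (2 * g)"
    by (intro tendsto_ennrealI) simp
  moreover have "\<exists>N. \<forall>n\<ge>N. distortion Y X (selection_graph Y X p) \<le> ennreal (2 * (g + inverse (real (Suc n))))"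
    using p(2) by simp
  ultimately have "distortion Y X (selection_graph Y X p) \<le> ennreal (2 * g)"
    by (rule LIMSEQ_le_const)
  then have "distortion Y X (selection_graph Y X p) / 2 \<le> ennreal (2 * g) / 2"
    by (rule divide_right_mono_ennreal)
  also have "\<dots> = gh_dist Y X"
    using real divide_ennreal[of "2 * g" 2] by simp
  finally show ?thesis
    using p(1) unfolding optimal_correspondence_iff topT
    by (intro exI[of _ "selection_graph Y X p"] conjI correspondence_selection_graph) auto
qed

section \<open>Correspondences with a simplex\<close>

text \<open>Keep one representative of each colour that occurs, and give the missing colours to some of the
  other points; there are enough of these by the assumption on cardinalities.  A recoloured
  point is alone in its new class, so classes only get smaller.\<close>

lemma exists_surjective_refinement:
  assumes c0: "c0 ` A \<subseteq> I" and fin: "finite I" and card: "finite A \<longrightarrow> card I \<le> card A"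
  obtains c where "c ` A = I" "\<forall>x\<in>A. \<forall>x'\<in>A. c x = c x' \<longrightarrow> c0 x = c0 x'"
proof -
  \<comment> \<open>\<open>S0\<close> contains one representative of each colour, and \<open>T\<close> the points to be recoloured.\<close>
  obtain S0 where S0: "S0 \<subseteq> A" "inj_on c0 S0" "c0 ` S0 = c0 ` A"
    by (metis subset_image_inj order_refl)
  have fin0: "finite (c0 ` A)" using c0 fin by (rule finite_subset)
  have finS0: "finite S0" using S0 fin0 by (metis finite_image_iff)
  have cardS0: "card S0 = card (c0 ` A)" using S0 by (metis card_image)
  have "finite (A - S0) \<longrightarrow> card (I - c0 ` A) \<le> card (A - S0)"
    using card finS0 S0(1) c0 fin0 cardS0 by (auto simp: card_Diff_subset)
  then obtain T where T: "T \<subseteq> A - S0" "finite T" "card T = card (I - c0 ` A)"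
    by (metis infinite_arbitrarily_large obtain_subset_with_card_n)
  then obtain h where h: "bij_betw h T (I - c0 ` A)"
    using fin by (metis finite_same_card_bij finite_Diff)
  define c where "c x = (if x \<in> T then h x else c0 x)" for x
  have hT: "h ` T = I - c0 ` A" "inj_on h T" using h by (auto simp: bij_betw_def)
  show thesis
  proof
    have "c0 ` A = c0 ` (A - T)"
    proof
      have "S0 \<subseteq> A - T" using S0(1) T(1) by blast
      then show "c0 ` A \<subseteq> c0 ` (A - T)" unfolding S0(3)[symmetric] by (rule image_mono)
    qed blast
    moreover have "c ` A = h ` T \<union> c0 ` (A - T)"
      using T(1) by (auto simp: c_def)
    ultimately show "c ` A = I" using hT c0 by auto
    show "\<forall>x\<in>A. \<forall>x'\<in>A. c x = c x' \<longrightarrow> c0 x = c0 x'"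
      using hT by (auto simp: c_def inj_on_def split: if_splits)
  qed
qed

text \<open>If the sets \<open>R `` {i}\<close> overlap, selecting one vertex for each point may leave some vertices
  without a point.  But then the distortion is at least \<open>l\<close>, which is what allows
  splitting classes: the points separated by it have a defect of at most \<open>l\<close>, or else one that the
  splitting has not increased.\<close>

lemma exists_partition_distortion_le:
  fixes X :: "'a metric"
  assumes l: "0 < l" and card: "finite (mspace X) \<longrightarrow> m \<le> card (mspace X)"
    and R: "correspondence (simplex_metric l m) X R"
  obtains c where "c ` mspace X = {1..m}"
    "distortion (simplex_metric l m) X {(c x, x) | x. x \<in> mspace X}
      \<le> distortion (simplex_metric l m) X R"
proof -
  have RY: "fst ` R = {1..m}" and RX: "snd ` R = mspace X"
    using R by (auto simp: correspondence_def mspace_simplex_metric[OF l])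
  define B where "B = distortion (simplex_metric l m) X R"
  have B: "ennreal \<bar>(if i = j then 0 else l) - mdist X x x'\<bar> \<le> B"
    if "(i, x) \<in> R" "(j, x') \<in> R" for i j x x'
    using distortion_le_iff[of "simplex_metric l m" X R B] that
    by (fastforce simp: B_def mdist_simplex_metric[OF l])
  have "\<forall>x\<in>mspace X. \<exists>i. (i, x) \<in> R" using RX by force
  then obtain c0 where c0: "\<And>x. x \<in> mspace X \<Longrightarrow> (c0 x, x) \<in> R" by metis
  show thesis
  proof (cases "\<exists>x i j. (i, x) \<in> R \<and> (j, x) \<in> R \<and> i \<noteq> j")
    case False
    have eq: "{(c0 x, x) | x. x \<in> mspace X} = R"
    proof
      show "R \<subseteq> {(c0 x, x) | x. x \<in> mspace X}"
      proof clarify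
        fix i x assume ix: "(i, x) \<in> R"
        then have "x \<in> mspace X" using RX by (metis image_eqI snd_conv)
        then show "\<exists>x'. (i, x) = (c0 x', x') \<and> x' \<in> mspace X"
          using False c0 ix by blast
      qed
    qed (use c0 in blast)
    have "c0 ` mspace X = fst ` {(c0 x, x) | x. x \<in> mspace X}" by force
    then show thesis using that[of c0] eq RY by simp
  next
    case True
    then obtain z i j where "(i, z) \<in> R" "(j, z) \<in> R" "i \<noteq> j" by blast
    moreover have "z \<in> mspace X" using RX calculation(1) by force
    moreover have "mdist X z z = 0" using \<open>z \<in> mspace X\<close> by simp
    ultimately have lB: "ennreal l \<le> B"
      using B[of i z j z] l \<open>mdist X z z = 0\<close> by simp
    have sub: "c0 ` mspace X \<subseteq> {1..m}" using c0 RY by force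
    have "finite (mspace X) \<longrightarrow> card {1..m} \<le> card (mspace X)" using card by simp
    then obtain c where c: "c ` mspace X = {1..m}"
      "\<forall>x\<in>mspace X. \<forall>x'\<in>mspace X. c x = c x' \<longrightarrow> c0 x = c0 x'"
      by (rule exists_surjective_refinement[OF sub finite_atLeastAtMost])
    have "ennreal \<bar>(if c x = c x' then 0 else l) - mdist X x x'\<bar> \<le> B"
      if x: "x \<in> mspace X" "x' \<in> mspace X" for x x'
    proof (cases "c x \<noteq> c x' \<and> mdist X x x' \<le> l")
      case True
      then have "ennreal \<bar>l - mdist X x x'\<bar> \<le> ennreal l" by (intro ennreal_leI) simp
      then show ?thesis using True order_trans[OF _ lB] by simp
    next
      \<comment> \<open>Equal colours were equal before; different colours at a distance above \<open>l\<close> have the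
        smallest possible defect.\<close>
      case False
      then have "\<bar>(if c x = c x' then 0 else l) - mdist X x x'\<bar>
          \<le> \<bar>(if c0 x = c0 x' then 0 else l) - mdist X x x'\<bar>"
        using c(2)[rule_format, OF x] l by auto
      then show ?thesis using order_trans[OF ennreal_leI B[OF c0 c0, OF x]] by blast
    qed
    then show thesis
      using that[OF c(1)] unfolding distortion_le_iff B_def[symmetric]
      by (auto simp: mdist_simplex_metric[OF l])
  qed
qed

lemma irreducible_correspondence_graph:
  assumes "c ` mspace X = mspace Y"
  shows "irreducible_correspondence Y X {(c x, x) | x. x \<in> mspace X}"
proof -
  let ?R = "{(c x, x) | x. x \<in> mspace X}"
  have "fst ` ?R = c ` mspace X" "snd ` ?R = mspace X" by force+
  then have "correspondence Y X ?R"
    using assms by (auto simp: correspondence_def)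
  moreover have "?R \<subseteq> S" if "correspondence Y X S" "S \<subseteq> ?R" for S
  proof clarify
    fix x assume "x \<in> mspace X"
    then have "x \<in> snd ` S" using that(1) by (simp add: correspondence_def)
    then show "(c x, x) \<in> S" using that(2) by auto
  qed
  ultimately show ?thesis by (auto simp: irreducible_correspondence_def)
qed

text \<open>Every colouring \<open>c\<close> of \<open>X\<close> with all \<open>m\<close> colours gives a partition.  If \<open>X\<close> has exactly \<open>m\<close> points,
  \<open>c\<close> is onto a set of the same finite size, hence bijective.\<close>

theorem theorem4p2:
  fixes X :: "'a metric" and m :: nat and l :: real
  assumes "compact_space (mtopology_of X)"
    and "1 \<le> m"
    and "finite (mspace X) \<longrightarrow> m \<le> card (mspace X)"
    and "0 < l"
  shows "\<exists>R \<in> R0_opt (simplex_metric l m) X.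
      (\<forall>i \<in> mspace (simplex_metric l m). R `` {i} \<noteq> {}) \<and>
      disjoint_family_on (\<lambda>i. R `` {i}) (mspace (simplex_metric l m)) \<and>
      (\<Union>i \<in> mspace (simplex_metric l m). R `` {i}) = mspace X \<and>
      (finite (mspace X) \<and> m = card (mspace X) \<longrightarrow>
        (\<exists>f. bij_betw f (mspace (simplex_metric l m)) (mspace X) \<and>
             R = {(i, f i) | i. i \<in> mspace (simplex_metric l m)}))"
proof -
  let ?Y = "simplex_metric l m"
  have Y: "mspace ?Y = {1..m}" using assms(4) by (rule mspace_simplex_metric)
  have "compact_space (mtopology_of ?Y)"
    unfolding compact_space_def by (rule finite_imp_compactin) (auto simp: Y)
  moreover have "mspace X \<noteq> {}" "mspace ?Y \<noteq> {}" using assms(2,3) by (auto simp: Y)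
  ultimately obtain R0 where R0: "optimal_correspondence ?Y X R0"
    using exists_optimal_correspondence[OF _ assms(1)] by blast
  then obtain c where c: "c ` mspace X = {1..m}"
    "distortion ?Y X {(c x, x) | x. x \<in> mspace X} \<le> distortion ?Y X R0"
    using exists_partition_distortion_le[OF assms(4,3)]
    unfolding optimal_correspondence_def by blast
  define R where "R = {(c x, x) | x. x \<in> mspace X}"
  have irr: "irreducible_correspondence ?Y X R"
    unfolding R_def using c(1) by (intro irreducible_correspondence_graph) (simp add: Y)
  have "distortion ?Y X R / 2 \<le> distortion ?Y X R0 / 2"
    using c(2) unfolding R_def by (rule divide_right_mono_ennreal)
  then have "optimal_correspondence ?Y X R"
    using irr R0 unfolding optimal_correspondence_iff irreducible_correspondence_def
    by (meson order_trans)
  then have opt: "R \<in> R0_opt ?Y X" using irr by (simp add: R0_opt_def)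
  have parts: "R `` {i} = {x \<in> mspace X. c x = i}" for i
    by (auto simp: R_def)
  have "\<exists>f. bij_betw f {1..m} (mspace X) \<and> R = {(i, f i) | i. i \<in> {1..m}}"
    if "finite (mspace X)" "m = card (mspace X)"
  proof -
    have bij: "bij_betw c (mspace X) {1..m}"
      using that c(1) by (auto simp: bij_betw_def intro: eq_card_imp_inj_on)
    show ?thesis
    proof (intro exI conjI)
      show "bij_betw (the_inv_into (mspace X) c) {1..m} (mspace X)"
        using bij by (rule bij_betw_the_inv_into)
      show "R = {(i, the_inv_into (mspace X) c i) | i. i \<in> {1..m}}"
      proof -
        have "the_inv_into (mspace X) c (c x) = x" if "x \<in> mspace X" for x
          using bij that by (simp add: bij_betw_def the_inv_into_f_f)
        then show ?thesis
          unfolding R_def c(1)[symmetric] by auto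
      qed
    qed
  qed
  moreover have "\<exists>x. x \<in> mspace X \<and> c x = i" if "i \<in> {1..m}" for i
    using that c(1) by (metis imageE)
  ultimately show ?thesis
    using c(1) by (intro bexI[OF _ opt]) (simp only: Y parts disjoint_family_on_def, auto)
qed

end
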